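(* For every $c>0$ there exists an analytic polynomial $F$ on the unit bi-disc such that \[ \big\|F\big\|_{A(D^2)}\leq 1,\quad \left\|\frac{\partial}{\partial z_1}F\right\|_{A(D^2)}\leq 1,\quad \left\|\frac{\partial}{\partial z_2}F\right\|_{A(D^2)}\leq 1, \] and \[ \left\|\frac{\partial^2}{\partial z^2_1}F\right\|_{A(D^2)}\leq 1,\quad \left\|\frac{\partial^2}{\partial z^2_2}F\right\|_{A(D^2)}\leq 1 \] but \[ \left\|\frac{\partial^2}{\partial z_1 \partial z_2} F\right\|_{A(D^2)}\geq c. \]
   Context: $D^2=\{(z_1,z_2)\in\mathbb{C}^2: |z_1|<1,\ |z_2|<1\}$ is the unit bi-disc. An analytic polynomial is a polynomial in the two complex variables $z_1,z_2$ with complex coefficients. $\|G\|_{A(D^2)}=\sup_{z\in D^2}|G(z)|$ is the supremum norm. *)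

theory Defs
  imports "HOL-Complex_Analysis.Complex_Analysis"
begin

definition bidisc :: "(complex \<times> complex) set" where
  "bidisc = {(z1, z2). cmod z1 < 1 \<and> cmod z2 < 1}"

definition analytic_polynomial :: "(complex \<times> complex \<Rightarrow> complex) \<Rightarrow> bool" where
  "analytic_polynomial G \<longleftrightarrow>
     (\<exists>(n::nat) (a::nat \<Rightarrow> nat \<Rightarrow> complex).
        \<forall>z1 z2. G (z1, z2) = (\<Sum>j\<le>n. \<Sum>k\<le>n. a j k * z1 ^ j * z2 ^ k))"

text \<open>The supremum is taken in the extended reals, so an unbounded function has norm \<open>\<infinity>\<close>
  (a real-valued supremum would be unspecified there).\<close>

definition bidisc_norm :: "(complex \<times> complex \<Rightarrow> complex) \<Rightarrow> ereal" where
  "bidisc_norm G = (SUP z\<in>bidisc. ereal (cmod (G z)))"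

definition partial1 :: "(complex \<times> complex \<Rightarrow> complex) \<Rightarrow> complex \<times> complex \<Rightarrow> complex" where
  "partial1 G = (\<lambda>(z1, z2). deriv (\<lambda>w. G (w, z2)) z1)"

definition partial2 :: "(complex \<times> complex \<Rightarrow> complex) \<Rightarrow> complex \<times> complex \<Rightarrow> complex" where
  "partial2 G = (\<lambda>(z1, z2). deriv (\<lambda>w. G (z1, w)) z2)"

end

(* For m = 2^n the polynomial p(z) = (1 - z^m) (1 + z + ... + z^(m-1)) / m lives at distance 1/m
   from the point 1: |p(z)| is at most 4 min(m |1-z|, 1/(m |1-z|)), while p' and p'' have size m and
   m^2 and p'(1) = -m.  In F = sum over n < N of 4^(-n) p(z1) p(z2), the derivative d^2/dz1^2 is
   dominated by the sum of the |p(z2)|, which is bounded independently of N and z2 because the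
   scales are lacunary; but every term contributes exactly 1 to d^2/dz1 dz2 at (1,1). *)
theory Submission imports Defs begin

section \<open>Sums of products of one-variable polynomials on the bidisc\<close>

lemma analytic_polynomial_sum_prod:
  fixes P Q :: "'i \<Rightarrow> complex poly"
  assumes "finite I"
  shows "analytic_polynomial (\<lambda>(z1, z2). \<Sum>i\<in>I. poly (P i) z1 * poly (Q i) z2)"
proof -
  \<comment> \<open>A common degree bound for all factors lets the coefficient arrays of the
    products be added entrywise.\<close>
  define D where "D = (\<Sum>i\<in>I. degree (P i) + degree (Q i))"
  have D: "degree (P i) \<le> D" "degree (Q i) \<le> D" if "i \<in> I" for i
    using member_le_sum[of i I "\<lambda>i. degree (P i) + degree (Q i)"] that assms
    unfolding D_def by auto
  have expand: "poly q z = (\<Sum>j\<le>D. coeff q j * z ^ j)" if "degree q \<le> D" for q and z :: complex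
    unfolding poly_altdef using that
    by (intro sum.mono_neutral_left) (auto simp: coeff_eq_0)
  have "(\<Sum>i\<in>I. poly (P i) z1 * poly (Q i) z2) =
      (\<Sum>j\<le>D. \<Sum>k\<le>D. (\<Sum>i\<in>I. coeff (P i) j * coeff (Q i) k) * z1 ^ j * z2 ^ k)" for z1 z2
  proof -
    have "(\<Sum>i\<in>I. poly (P i) z1 * poly (Q i) z2) =
        (\<Sum>i\<in>I. \<Sum>j\<le>D. \<Sum>k\<le>D. coeff (P i) j * coeff (Q i) k * z1 ^ j * z2 ^ k)"
      using D by (intro sum.cong) (auto simp: expand sum_product mult_ac)
    also have "\<dots> = (\<Sum>j\<le>D. \<Sum>i\<in>I. \<Sum>k\<le>D. coeff (P i) j * coeff (Q i) k * z1 ^ j * z2 ^ k)"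
      by (rule sum.swap)
    also have "\<dots> = (\<Sum>j\<le>D. \<Sum>k\<le>D. \<Sum>i\<in>I. coeff (P i) j * coeff (Q i) k * z1 ^ j * z2 ^ k)"
      by (intro sum.cong sum.swap refl)
    finally show ?thesis by (simp add: sum_distrib_right)
  qed
  then show ?thesis
    unfolding analytic_polynomial_def
    by (intro exI[of _ D] exI[of _ "\<lambda>j k. \<Sum>i\<in>I. coeff (P i) j * coeff (Q i) k"]) auto
qed

text \<open>The derivative has the same shape again, so iterated and mixed partials are computed by
  repeated rewriting.\<close>

lemma partial1_sum_prod:
  "partial1 (\<lambda>(z1, z2). \<Sum>i\<in>I. poly (P i) z1 * poly (Q i) z2) =
    (\<lambda>(z1, z2). \<Sum>i\<in>I. poly (pderiv (P i)) z1 * poly (Q i) z2)"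
  unfolding partial1_def
  by (auto simp: fun_eq_iff intro!: DERIV_imp_deriv derivative_eq_intros)

lemma partial2_sum_prod:
  "partial2 (\<lambda>(z1, z2). \<Sum>i\<in>I. poly (P i) z1 * poly (Q i) z2) =
    (\<lambda>(z1, z2). \<Sum>i\<in>I. poly (P i) z1 * poly (pderiv (Q i)) z2)"
  unfolding partial2_def
  by (auto simp: fun_eq_iff mult_ac intro!: DERIV_imp_deriv derivative_eq_intros)

lemma bidisc_norm_leI:
  assumes "\<And>z1 z2. cmod z1 < 1 \<Longrightarrow> cmod z2 < 1 \<Longrightarrow> cmod (G (z1, z2)) \<le> C"
  shows "bidisc_norm G \<le> ereal C"
  unfolding bidisc_norm_def bidisc_def by (intro SUP_least) (auto intro: assms)

lemma bidisc_norm_geI: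
  assumes "cmod z1 < 1" "cmod z2 < 1" "C \<le> cmod (G (z1, z2))"
  shows "ereal C \<le> bidisc_norm G"
  unfolding bidisc_norm_def
  by (rule SUP_upper2[of "(z1, z2)"]) (use assms in \<open>auto simp: bidisc_def\<close>)

section \<open>A scale-invariant dyadic sum\<close>

text \<open>The terms double while \<open>x * 2 ^ n\<close> is below 1 and halve afterwards, so the
  bound depends on neither \<open>x\<close> nor \<open>N\<close>.\<close>

lemma dyadic_min_sum_le:
  fixes x :: real
  assumes "x > 0"
  shows "(\<Sum>n<N. min (x * 2 ^ n) (1 / (x * 2 ^ n))) \<le> 3"
proof -
  (* A supersolution of the recursion S(x) = min x (1/x) + S(2x) satisfied by the sums. *)
  define pot :: "real \<Rightarrow> real" where "pot x = (if x \<ge> 1 then 2 / x else 3 - x)" for x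
  have step: "min x (1 / x) + pot (2 * x) \<le> pot x" if "x > 0" for x
  proof -
    consider "x \<ge> 1" | "1/2 \<le> x" "x < 1" | "x < 1/2" by linarith
    then show ?thesis
    proof cases
      case 1
      then show ?thesis by (simp add: pot_def min_def field_simps)
    next
      case 2
      \<comment> \<open>Here \<open>pot (2 * x) = 1 / x\<close>. Multiplied by \<open>x\<close>, the
        claim is \<open>2 * x^2 - 3 * x + 1 \<le> 0\<close>, whose roots are the ends of this range.
        In the other two cases equality holds.\<close>
      have "(2 * x - 1) * (x - 1) \<le> 0" using 2 by (intro mult_nonneg_nonpos) auto
      then have "x + 1 / x \<le> 3 - x" using 2 by (simp add: field_simps)
      then show ?thesis using 2 by (simp add: pot_def min_def)
    next
      case 3
      then show ?thesis by (simp add: pot_def min_def)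
    qed
  qed
  have "(\<Sum>n<N. min (x * 2 ^ n) (1 / (x * 2 ^ n))) \<le> pot x"
    using assms
  proof (induction N arbitrary: x)
    case 0
    then show ?case by (simp add: pot_def)
  next
    case (Suc N)
    have "(\<Sum>n<Suc N. min (x * 2 ^ n) (1 / (x * 2 ^ n))) =
        min x (1 / x) + (\<Sum>n<N. min (2 * x * 2 ^ n) (1 / (2 * x * 2 ^ n)))"
      by (simp add: sum.lessThan_Suc_shift mult_ac del: sum.lessThan_Suc)
    also have "\<dots> \<le> min x (1 / x) + pot (2 * x)"
      using Suc.IH[of "2 * x"] Suc.prems by simp
    also have "\<dots> \<le> pot x" using step Suc.prems by blast
    finally show ?case .
  qed
  also have "pot x \<le> 3" using assms by (auto simp: pot_def divide_simps)
  finally show ?thesis .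
qed

section \<open>Bump polynomials and their derivatives\<close>

text \<open>The expanded form makes termwise differentiation direct; the product form used for size
  estimates is \<open>poly_bump\<close>.\<close>

definition bump :: "nat \<Rightarrow> complex poly" where
  "bump m = (\<Sum>j<m. monom (1 / of_nat m) j - monom (1 / of_nat m) (j + m))"

lemma poly_bump: "poly (bump m) z = (1 - z ^ m) * (\<Sum>j<m. z ^ j) / of_nat m"
  by (simp add: bump_def poly_sum poly_monom power_add sum_distrib_left sum_divide_distrib
      algebra_simps diff_divide_distrib)

lemma pderiv_sum: "pderiv (sum f A) = (\<Sum>x\<in>A. pderiv (f x))"
  using higher_pderiv_sum[of 1 f A] by simp

lemma poly_pderiv_bump:
  "poly (pderiv (bump m)) z =
    (\<Sum>j<m. (of_nat j * z ^ (j - 1) - of_nat (j + m) * z ^ (j + m - 1)) / of_nat m)"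
  by (simp add: bump_def pderiv_sum pderiv_diff pderiv_monom poly_sum poly_monom
      diff_divide_distrib)

text \<open>Whenever subtraction in an exponent truncates, the coefficient in front of that power
  vanishes.\<close>

lemma poly_pderiv2_bump:
  "poly (pderiv (pderiv (bump m))) z =
    (\<Sum>j<m. (of_nat (j * (j - 1)) * z ^ (j - 2) -
             of_nat ((j + m) * (j + m - 1)) * z ^ (j + m - 2)) / of_nat m)"
  by (simp add: bump_def pderiv_sum pderiv_diff pderiv_monom poly_sum poly_monom
      diff_divide_distrib numeral_2_eq_2 mult_ac)

lemma norm_one_minus_power_le: "cmod z \<le> 1 \<Longrightarrow> cmod (1 - z ^ m) \<le> 2"
  using norm_triangle_ineq4[of 1 "z ^ m"] power_le_one[of "cmod z" m]
  by (simp add: norm_power)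

lemma norm_geometric_sum_le: "cmod z \<le> 1 \<Longrightarrow> cmod (\<Sum>j<m. z ^ j) \<le> real m"
  using sum_norm_le[of "{..<m}" "\<lambda>j. z ^ j" "\<lambda>_. 1"] by (simp add: norm_power power_le_one)

lemma norm_monomial_diff_le:
  assumes "cmod z \<le> 1"
  shows "cmod ((of_nat a * z ^ k - of_nat b * z ^ l) / of_nat m) \<le> (real a + real b) / real m"
proof -
  have "cmod (of_nat a * z ^ k - of_nat b * z ^ l) \<le> cmod (of_nat a * z ^ k) + cmod (of_nat b * z ^ l)"
    by (rule norm_triangle_ineq4)
  also have "\<dots> \<le> real a * 1 + real b * 1"
    unfolding norm_mult norm_power norm_of_nat
    by (intro add_mono mult_left_mono power_le_one) (use assms in auto)
  finally show ?thesis by (simp add: norm_divide divide_right_mono)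
qed

lemma norm_bump_le:
  assumes "cmod z \<le> 1" "m > 0"
  shows "cmod (poly (bump m) z) \<le> 2"
proof -
  have "cmod (1 - z ^ m) * cmod (\<Sum>j<m. z ^ j) \<le> 2 * real m"
    using assms norm_one_minus_power_le norm_geometric_sum_le by (intro mult_mono) auto
  then show ?thesis using assms by (simp add: poly_bump norm_mult norm_divide pos_divide_le_eq)
qed

text \<open>With \<open>u\<close> the geometric sum, \<open>1 - z ^ m = (1 - z) * u\<close>, so the
  modulus is \<open>x * |u|^2 / m\<close> for \<open>x = |1 - z|\<close>. Then
  \<open>|u| \<le> m\<close> gives the bound near 1, and \<open>x * |u| \<le> 2\<close> the one away
  from 1.\<close>

lemma norm_bump_le_min:
  assumes "cmod z < 1" "m > 0"
  shows "cmod (poly (bump m) z) \<le>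
    4 * min (cmod (1 - z) * real m) (1 / (cmod (1 - z) * real m))"
proof -
  define x where "x = cmod (1 - z)"
  have x: "x > 0" using assms unfolding x_def by auto
  define u where "u = (\<Sum>j<m. z ^ j)"
  have u: "1 - z ^ m = (1 - z) * u" unfolding u_def by (rule one_diff_power_eq)
  have u_le: "cmod u \<le> real m"
    unfolding u_def using assms by (intro norm_geometric_sum_le) auto
  have xu_le: "x * cmod u \<le> 2"
    using norm_one_minus_power_le[of z m] assms by (simp add: u x_def norm_mult)
  have p: "cmod (poly (bump m) z) = x * cmod u * cmod u / real m"
    unfolding poly_bump u_def[symmetric] u by (simp add: x_def norm_mult norm_divide)
  have "cmod u * cmod u \<le> real m * real m"
    using u_le by (intro mult_mono) auto
  then have "x * (cmod u * cmod u) \<le> x * (real m * real m)"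
    using x by (intro mult_left_mono) auto
  then have near: "cmod (poly (bump m) z) \<le> x * real m"
    using assms(2) unfolding p by (simp add: field_simps)
  have "(x * cmod u) * (x * cmod u) \<le> 2 * 2"
    using xu_le x by (intro mult_mono) auto
  then have far: "cmod (poly (bump m) z) \<le> 4 / (x * real m)"
    using assms(2) x unfolding p by (simp add: field_simps)
  have "x * real m \<ge> 0" using x by simp
  then show ?thesis using near far unfolding x_def[symmetric] by (simp add: min_def)
qed

lemma norm_pderiv_bump_le:
  assumes "cmod z \<le> 1"
  shows "cmod (poly (pderiv (bump m)) z) \<le> 3 * real m"
proof -
  have "cmod (poly (pderiv (bump m)) z) \<le> (\<Sum>j<m. 3)"
    unfolding poly_pderiv_bump
  proof (intro sum_norm_le order.trans[OF norm_monomial_diff_le[OF assms]])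
    fix j assume "j \<in> {..<m}"
    then show "(real j + real (j + m)) / real m \<le> 3" by (simp add: field_simps)
  qed
  then show ?thesis by simp
qed

lemma norm_pderiv2_bump_le:
  assumes "cmod z \<le> 1"
  shows "cmod (poly (pderiv (pderiv (bump m))) z) \<le> 5 * (real m)\<^sup>2"
proof -
  have "cmod (poly (pderiv (pderiv (bump m))) z) \<le> (\<Sum>j<m. 5 * real m)"
    unfolding poly_pderiv2_bump
  proof (intro sum_norm_le order.trans[OF norm_monomial_diff_le[OF assms]])
    fix j assume "j \<in> {..<m}"
    \<comment> \<open>The estimate stays in the naturals, where subtraction truncates, and is cast
      to the reals only afterwards. The constant is 5 = 1 + 4.\<close>
    then have "j * (j - 1) \<le> m * m" "(j + m) * (j + m - 1) \<le> (2 * m) * (2 * m)"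
      by (intro mult_le_mono; simp)+
    then have "j * (j - 1) + (j + m) * (j + m - 1) \<le> 5 * m * m" by simp
    then have "real (j * (j - 1) + (j + m) * (j + m - 1)) \<le> real (5 * m * m)"
      by (rule of_nat_mono)
    then have "real (j * (j - 1)) + real ((j + m) * (j + m - 1)) \<le> 5 * real m * real m"
      by (simp only: of_nat_add of_nat_mult of_nat_numeral)
    then show "(real (j * (j - 1)) + real ((j + m) * (j + m - 1))) / real m \<le> 5 * real m"
      using \<open>j \<in> {..<m}\<close> by (simp add: pos_divide_le_eq)
  qed
  then show ?thesis by (simp add: power2_eq_square)
qed

text \<open>At 1 each of the \<open>m\<close> summands is
  \<open>(j - (j + m)) / m = -1\<close>.\<close>

lemma poly_pderiv_bump_1: "m > 0 \<Longrightarrow> poly (pderiv (bump m)) 1 = - of_nat m"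
  by (simp add: poly_pderiv_bump diff_divide_distrib add_divide_distrib sum_negf)

text \<open>The dyadic sum bound applies with \<open>x = |1 - z|\<close>, which is positive inside
  the disc.\<close>

lemma sum_norm_bump_le:
  assumes "cmod z < 1"
  shows "(\<Sum>n<N. cmod (poly (bump (2 ^ n)) z)) \<le> 12"
proof -
  have "(\<Sum>n<N. cmod (poly (bump (2 ^ n)) z)) \<le>
      (\<Sum>n<N. 4 * min (cmod (1 - z) * 2 ^ n) (1 / (cmod (1 - z) * 2 ^ n)))"
    by (intro sum_mono) (use norm_bump_le_min[OF assms, of "2 ^ n" for n] in simp)
  also have "\<dots> \<le> 4 * 3"
    unfolding sum_distrib_left[symmetric] using assms
    by (intro mult_left_mono dyadic_min_sum_le) auto
  finally show ?thesis by simp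
qed

lemma sum_half_powers_le: "(\<Sum>n<N. (1 / 2 :: real) ^ n) \<le> 2"
  by (simp add: geometric_sum)

section \<open>The lacunary sum and its derivatives\<close>

theorem theorem5:
  fixes c :: real
  assumes "c > 0"
  shows "\<exists>F :: complex \<times> complex \<Rightarrow> complex.
    analytic_polynomial F \<and>
    bidisc_norm F \<le> 1 \<and>
    bidisc_norm (partial1 F) \<le> 1 \<and>
    bidisc_norm (partial2 F) \<le> 1 \<and>
    bidisc_norm (partial1 (partial1 F)) \<le> 1 \<and>
    bidisc_norm (partial2 (partial2 F)) \<le> 1 \<and>
    bidisc_norm (partial1 (partial2 F)) \<ge> ereal c"
proof -
  \<comment> \<open>The mixed derivative at (1,1) will be \<open>N / 60\<close>.\<close>
  obtain N :: nat where N: "60 * c < real N" using reals_Archimedean2 by blast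
  define p where "p n = bump (2 ^ n)" for n
  \<comment> \<open>The normalisation is 60 = 5 * 12: the constant 5 comes from the second
    derivative of a bump, and 12 bounds the sum of the bumps.\<close>
  define P where "P n = smult (1 / (60 * 4 ^ n)) (p n)" for n
  define F where "F = (\<lambda>(z1, z2). \<Sum>n<N. poly (P n) z1 * poly (p n) z2)"
  note partials = F_def partial1_sum_prod partial2_sum_prod
  have P: "cmod (poly (P n) z) = cmod (poly (p n) z) / (60 * 4 ^ n)"
    "cmod (poly (pderiv (P n)) z) = cmod (poly (pderiv (p n)) z) / (60 * 4 ^ n)"
    "cmod (poly (pderiv (pderiv (P n))) z) = cmod (poly (pderiv (pderiv (p n))) z) / (60 * 4 ^ n)"
    for n z
    by (simp_all add: P_def pderiv_smult norm_mult norm_divide norm_power)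
  have p0: "cmod (poly (p n) z) \<le> 2"
    and p1: "cmod (poly (pderiv (p n)) z) \<le> 3 * 2 ^ n"
    and p2: "cmod (poly (pderiv (pderiv (p n))) z) \<le> 5 * 4 ^ n"
    if "cmod z < 1" for n z
    using norm_bump_le[of z "2 ^ n"] norm_pderiv_bump_le[of z "2 ^ n"]
      norm_pderiv2_bump_le[of z "2 ^ n"] that
    by (auto simp: p_def power2_eq_square simp flip: power_mult_distrib)
  \<comment> \<open>For derivatives of order at most one, the weight \<open>4 ^ n\<close> beats the
    growth \<open>2 ^ n\<close>. The factor 1/10 is 6/60, with 6 = 3 * 2 from the bounds
    \<open>p1\<close> and \<open>p0\<close>.\<close>
  have geometric: "bidisc_norm (\<lambda>(z1, z2). \<Sum>n<N. poly (A n) z1 * poly (B n) z2) \<le> ereal 1"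
    if "\<And>z1 z2 n. cmod z1 < 1 \<Longrightarrow> cmod z2 < 1 \<Longrightarrow>
      cmod (poly (A n) z1) * cmod (poly (B n) z2) \<le> (1 / 2) ^ n / 10" for A B
  proof (rule bidisc_norm_leI)
    fix z1 z2 :: complex assume z: "cmod z1 < 1" "cmod z2 < 1"
    have "cmod (\<Sum>n<N. poly (A n) z1 * poly (B n) z2) \<le> (\<Sum>n<N. (1 / 2) ^ n / 10)"
      using that[OF z] by (intro sum_norm_le) (simp add: norm_mult)
    also have "\<dots> \<le> 1"
      using sum_half_powers_le[of N] unfolding sum_divide_distrib[symmetric] by simp
    finally show "cmod (case (z1, z2) of (z1, z2) \<Rightarrow> \<Sum>n<N. poly (A n) z1 * poly (B n) z2) \<le> 1"
      by simp
  qed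
  have four: "(4::real) ^ n = 2 ^ n * 2 ^ n" for n
    by (simp flip: power_mult_distrib)
  have one_le: "(1::real) \<le> 2 ^ n" for n by simp
  have "bidisc_norm F \<le> 1"
    unfolding F_def one_ereal_def
  proof (rule geometric)
    fix z1 z2 n assume z: "cmod z1 < 1" "cmod z2 < 1"
    have "cmod (poly (p n) z1) * cmod (poly (p n) z2) \<le> 2 * 2"
      using p0 z by (intro mult_mono) auto
    also have "\<dots> \<le> 6 * 2 ^ n" using one_le[of n] by linarith
    finally show "cmod (poly (P n) z1) * cmod (poly (p n) z2) \<le> (1 / 2) ^ n / 10"
      by (simp add: P four field_simps)
  qed
  moreover have "bidisc_norm (partial1 F) \<le> 1"
    unfolding partials one_ereal_def
  proof (rule geometric)
    fix z1 z2 n assume z: "cmod z1 < 1" "cmod z2 < 1"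
    have "cmod (poly (pderiv (p n)) z1) * cmod (poly (p n) z2) \<le> (3 * 2 ^ n) * 2"
      using p0 p1 z by (intro mult_mono) auto
    then show "cmod (poly (pderiv (P n)) z1) * cmod (poly (p n) z2) \<le> (1 / 2) ^ n / 10"
      by (simp add: P four field_simps)
  qed
  moreover have "bidisc_norm (partial2 F) \<le> 1"
    unfolding partials one_ereal_def
  proof (rule geometric)
    fix z1 z2 n assume z: "cmod z1 < 1" "cmod z2 < 1"
    have "cmod (poly (p n) z1) * cmod (poly (pderiv (p n)) z2) \<le> 2 * (3 * 2 ^ n)"
      using p0 p1 z by (intro mult_mono) auto
    then show "cmod (poly (P n) z1) * cmod (poly (pderiv (p n)) z2) \<le> (1 / 2) ^ n / 10"
      by (simp add: P four field_simps)
  qed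
  moreover have "bidisc_norm (partial1 (partial1 F)) \<le> 1"
    unfolding partials one_ereal_def
  proof (rule bidisc_norm_leI)
    fix z1 z2 :: complex assume z: "cmod z1 < 1" "cmod z2 < 1"
    \<comment> \<open>Now the second derivative uses up the weight \<open>4 ^ n\<close> and no
      geometric decay remains. Summability comes from the undifferentiated factor; 5/60 =
      1/12.\<close>
    have "cmod (\<Sum>n<N. poly (pderiv (pderiv (P n))) z1 * poly (p n) z2) \<le>
        (\<Sum>n<N. cmod (poly (p n) z2) / 12)"
    proof (rule sum_norm_le)
      fix n
      have "cmod (poly (pderiv (pderiv (p n))) z1) * cmod (poly (p n) z2) \<le>
          5 * 4 ^ n * cmod (poly (p n) z2)"
        using p2 z by (intro mult_right_mono) auto
      then show "cmod (poly (pderiv (pderiv (P n))) z1 * poly (p n) z2) \<le> cmod (poly (p n) z2) / 12"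
        by (simp add: P norm_mult field_simps)
    qed
    also have "\<dots> \<le> 1"
      using sum_norm_bump_le[OF z(2), of N] by (simp add: p_def flip: sum_divide_distrib)
    finally show "cmod (case (z1, z2) of
        (z1, z2) \<Rightarrow> \<Sum>n<N. poly (pderiv (pderiv (P n))) z1 * poly (p n) z2) \<le> 1"
      by simp
  qed
  moreover have "bidisc_norm (partial2 (partial2 F)) \<le> 1"
    unfolding partials one_ereal_def
  proof (rule bidisc_norm_leI)
    fix z1 z2 :: complex assume z: "cmod z1 < 1" "cmod z2 < 1"
    have "cmod (\<Sum>n<N. poly (P n) z1 * poly (pderiv (pderiv (p n))) z2) \<le>
        (\<Sum>n<N. cmod (poly (p n) z1) / 12)"
    proof (rule sum_norm_le)
      fix n
      have "cmod (poly (p n) z1) * cmod (poly (pderiv (pderiv (p n))) z2) \<le>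
          cmod (poly (p n) z1) * (5 * 4 ^ n)"
        using p2 z by (intro mult_left_mono) auto
      then show "cmod (poly (P n) z1 * poly (pderiv (pderiv (p n))) z2) \<le> cmod (poly (p n) z1) / 12"
        by (simp add: P norm_mult field_simps)
    qed
    also have "\<dots> \<le> 1"
      using sum_norm_bump_le[OF z(1), of N] by (simp add: p_def flip: sum_divide_distrib)
    finally show "cmod (case (z1, z2) of
        (z1, z2) \<Rightarrow> \<Sum>n<N. poly (P n) z1 * poly (pderiv (pderiv (p n))) z2) \<le> 1"
      by simp
  qed
  moreover have "ereal c \<le> bidisc_norm (partial1 (partial2 F))"
  proof -
    \<comment> \<open>The point (1,1) lies outside the open bidisc, so the mixed derivative is
      followed along the diagonal and the strict inequality at 1 is carried to some
      \<open>r < 1\<close> by continuity.\<close>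
    define h where
      "h r = cmod (\<Sum>n<N. poly (pderiv (P n)) (of_real r) * poly (pderiv (p n)) (of_real r))" for r
    have "isCont h 1" unfolding h_def by (intro continuous_intros)
    then have "(h \<longlongrightarrow> h 1) (at_left 1)" by (simp add: isCont_def filterlim_at_split)
    \<comment> \<open>The two derivatives contribute \<open>(- 2 ^ n) * (- 2 ^ n) = 4 ^ n\<close>,
      which cancels the weight, so all terms are equal and add without cancellation.\<close>
    moreover have "poly (pderiv (P n)) 1 * poly (pderiv (p n)) 1 = 1 / 60" for n
      by (simp add: P_def p_def pderiv_smult poly_pderiv_bump_1 flip: power_mult_distrib)
    then have "h 1 = cmod (\<Sum>n<N. 1 / 60)" by (simp only: h_def of_real_1)
    then have "c < h 1" using N by (simp add: norm_divide)
    ultimately have "\<forall>\<^sub>F r in at_left 1. c < h r"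
      by (rule order_tendstoD(1))
    moreover have "\<forall>\<^sub>F r in at_left (1::real). r \<in> {0<..<1}"
      by (rule eventually_at_left_real) simp
    ultimately have "\<exists>r. c < h r \<and> r \<in> {0<..<1}"
      by (intro eventually_happens'[OF _ eventually_conj]) auto
    then obtain r where "c < h r" "0 < r" "r < 1" by auto
    then show ?thesis
      unfolding partials by (intro bidisc_norm_geI[of "of_real r" "of_real r"]) (auto simp: h_def)
  qed
  moreover have "analytic_polynomial F"
    unfolding F_def by (intro analytic_polynomial_sum_prod) simp
  ultimately show ?thesis by blast
qed

end
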